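(* Let $N$ be a positive integer and let $\mu_1,\dots,\mu_N>0$. For any $P_1,\dots,P_N\in\mathbb{N}$ and any $\beta\ge0$, there exists a number $\varepsilon_2=\varepsilon_2(\mu_1,\dots,\mu_N;P_1,\dots,P_N;\beta)>0$ such that, if $\beta_{ij}\in[-\varepsilon_2,\beta]$ for all $i,j=1,\dots,N$ with $i\ne j$, then both of the following hold. (a) There is no $(u_1,\dots,u_N)\neq(0,\dots,0)$ satisfying for $j=1,\dots,N$: $-u_j''=\mu_ju_j^3+\sum_{i\ne j}\beta_{ij}u_i^2u_j$ in $\mathbb{R}$; $u_j\in C^2(\mathbb{R})$ and $u_j$ is radial; $u_j$ is identically zero or changes its sign at most $P_j$ times; and $|u_j|_{L^\infty(\mathbb{R})}\le1$. (b) There is no $(u_1,\dots,u_N)\neq(0,\dots,0)$ satisfying for $j=1,\dots,N$: $-u_j''=\mu_ju_j^3+\sum_{i\ne j}\beta_{ij}u_i^2u_j$ in $[0,+\infty)$; $u_j\in C^2([0,+\infty))$; $u_j$ is identically zero or changes its sign at most $P_j$ times; $|u_j|_{L^\infty([0,+\infty))}\le1$; and $u_j(0)=0$.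
   Context: $\mathbb{N}=\{0,1,2,\dots\}$. A function on $\mathbb{R}$ is radial if it depends only on $|x|$, i.e. it is even. For a continuous function $u$ that is radial on $\mathbb{R}$, or defined on $[0,+\infty)$, the number of sign changes (number of nodes) $n(u)$ is the largest integer $k\ge 0$ for which there are numbers $0<x_0<x_1<\dots<x_k$ with $u(x_j)u(x_{j+1})<0$ for $j=0,\dots,k-1$; "$u$ changes its sign at most $P$ times" means $n(u)\le P$. *)

theory Defs
  imports "HOL-Analysis.Analysis" "HOL-Probability.Essential_Supremum"
begin

text \<open>Derivatives are taken relative to the domain \<open>S\<close> (here \<open>\<real>\<close> or \<open>[0,\<infinity>)\<close>), so they are
  one-sided at the endpoint of a half-line and never depend on values outside \<open>S\<close>.\<close>

definition deriv_on :: "real set \<Rightarrow> (real \<Rightarrow> real) \<Rightarrow> real \<Rightarrow> real" where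
  "deriv_on S u x = vector_derivative u (at x within S)"

definition C2_on :: "real set \<Rightarrow> (real \<Rightarrow> real) \<Rightarrow> bool" where
  "C2_on S u \<longleftrightarrow> u differentiable_on S \<and> deriv_on S u differentiable_on S \<and>
     continuous_on S (deriv_on S (deriv_on S u))"

definition radial :: "(real \<Rightarrow> real) \<Rightarrow> bool" where
  "radial u \<longleftrightarrow> (\<forall>x y. \<bar>x\<bar> = \<bar>y\<bar> \<longrightarrow> u x = u y)"

definition alternates :: "(real \<Rightarrow> real) \<Rightarrow> nat \<Rightarrow> bool" where
  "alternates u k \<longleftrightarrow> (\<exists>x :: nat \<Rightarrow> real. 0 < x 0 \<and> strict_mono_on {..k} x \<and>
     (\<forall>j<k. u (x j) * u (x (Suc j)) < 0))"

text \<open>The value is \<open>\<infinity>\<close> if there are alternating sequences of every length. For both domains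
  only points of \<open>(0,\<infinity>)\<close> are tested, so no domain argument is needed.\<close>

definition num_nodes :: "(real \<Rightarrow> real) \<Rightarrow> enat" where
  "num_nodes u = Sup (enat ` {k. alternates u k})"

definition Linf_norm :: "real set \<Rightarrow> (real \<Rightarrow> real) \<Rightarrow> ereal" where
  "Linf_norm S u = esssup (lebesgue_on S) (\<lambda>x. ereal \<bar>u x\<bar>)"

definition solves_system ::
  "real set \<Rightarrow> nat \<Rightarrow> (nat \<Rightarrow> real) \<Rightarrow> (nat \<Rightarrow> nat \<Rightarrow> real) \<Rightarrow> (nat \<Rightarrow> real \<Rightarrow> real) \<Rightarrow> bool" where
  "solves_system S N \<mu> b u \<longleftrightarrow> (\<forall>j\<in>{1..N}. \<forall>x\<in>S.
     - deriv_on S (deriv_on S (u j)) x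
       = \<mu> j * (u j x)^3 + (\<Sum>i\<in>{1..N} - {j}. b i j * (u i x)^2 * u j x))"

end

theory Submission
  imports Defs
begin

text \<open>
  A nontrivial solution of either problem is nontrivial on the open half-line \<open>x > 0\<close>: by evenness
  and continuity in (a), because of \<open>u\<^sub>j 0 = 0\<close> in (b).  The contradiction comes from the half-line
  alone.  Let \<open>A\<close> be the supremum of all
  \<open>\<bar>u\<^sub>i x\<bar>\<close> over \<open>x > 0\<close> and pick a component \<open>u\<^sub>j\<close> and a point \<open>a > 0\<close> with
  \<open>\<bar>u\<^sub>j a\<bar> > A / 2\<close>.  The other components are then visible only through the coefficient \<open>c\<close>
  of the linear equation \<open>u\<^sub>j'' = - c u\<^sub>j\<close>, where \<open>c \<ge> \<mu>\<^sub>j u\<^sub>j\<^sup>2 - \<epsilon> A\<^sup>2\<close> and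
  \<open>\<bar>c\<bar> \<le> C A\<^sup>2\<close>.  The rescaling \<open>v x = u\<^sub>j (x / A) / A\<close> turns \<open>A\<close> into \<open>1\<close>.

  The theorem therefore follows once such a \<open>v\<close> with \<open>\<bar>v a\<bar> \<ge> m\<close> is known to have as many sign
  changes after \<open>a\<close> as desired, provided that \<open>\<epsilon>\<close> is small in terms of that number.  For \<open>\<epsilon> = 0\<close>
  and positive \<open>v\<close> this would be the elementary fact that a concave function bounded from below on
  a half-line cannot decrease, so that \<open>v'' \<le> - \<mu> m\<^sup>3\<close> throughout, which contradicts boundedness.
  Lemma \<open>drops_below\<close> is the quantitative version on an interval whose length depends only on
  \<open>m\<close> and \<open>\<mu>\<close>: it tolerates a small \<open>\<epsilon>\<close>, and even small negative values of \<open>v\<close>, so it gives a later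
  point with \<open>v \<le> - m'\<close>, where \<open>m' > 0\<close> depends only on \<open>\<mu>\<close>, \<open>C\<close> and \<open>m\<close>.  Since the size of \<open>v\<close> after the sign change is
  controlled, the step can be repeated (lemma \<open>many_sign_changes\<close>).
\<close>

section \<open>Second order equations with an almost positive coefficient\<close>

text \<open>The derivative and the coefficient \<open>c\<close> are hidden because the argument passes from \<open>v\<close> to
  \<open>- v\<close> and to later starting points; only the bounds on \<open>c\<close> matter.\<close>

definition oscillator :: "real \<Rightarrow> real \<Rightarrow> real \<Rightarrow> real \<Rightarrow> (real \<Rightarrow> real) \<Rightarrow> bool" where
  "oscillator \<mu> C \<epsilon> a v \<longleftrightarrow> (\<exists>v' c. \<forall>x\<ge>a.
     (v has_real_derivative v' x) (at x) \<and> (v' has_real_derivative - (c x * v x)) (at x) \<and>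
     \<bar>v x\<bar> \<le> 1 \<and> \<mu> * (v x)\<^sup>2 - \<epsilon> \<le> c x \<and> \<bar>c x\<bar> \<le> C)"

lemma oscillator_weaken:
  assumes "oscillator \<mu> C \<epsilon> a v" "a \<le> b" "\<epsilon> \<le> \<epsilon>'"
  shows "oscillator \<mu> C \<epsilon>' b v"
  using assms unfolding oscillator_def by (smt (verit, best))

lemma oscillator_uminus:
  assumes "oscillator \<mu> C \<epsilon> a v"
  shows "oscillator \<mu> C \<epsilon> a (\<lambda>x. - v x)"
proof -
  obtain v' c where *: "\<forall>x\<ge>a.
     (v has_real_derivative v' x) (at x) \<and> (v' has_real_derivative - (c x * v x)) (at x) \<and>
     \<bar>v x\<bar> \<le> 1 \<and> \<mu> * (v x)\<^sup>2 - \<epsilon> \<le> c x \<and> \<bar>c x\<bar> \<le> C"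
    using assms unfolding oscillator_def by blast
  show ?thesis
    unfolding oscillator_def
    using * by (intro exI[of _ "\<lambda>x. - v' x"] exI[of _ c]) (auto intro!: derivative_eq_intros)
qed

text \<open>A bound on \<open>v''\<close> is used through the concave function obtained by subtracting a parabola.\<close>

lemma concave_minus_parabola:
  fixes v v' v'' :: "real \<Rightarrow> real"
  assumes "\<And>x. x \<in> {a..b} \<Longrightarrow> (v has_real_derivative v' x) (at x)"
    and "\<And>x. x \<in> {a..b} \<Longrightarrow> (v' has_real_derivative v'' x) (at x)"
    and "\<And>x. x \<in> {a..b} \<Longrightarrow> v'' x \<le> \<eta>"
  shows "concave_on {a..b} (\<lambda>x. v x - \<eta> / 2 * (x - a)\<^sup>2)"
proof (rule f''_le0_imp_concave)
  show "((\<lambda>x. v x - \<eta> / 2 * (x - a)\<^sup>2) has_real_derivative v' x - \<eta> * (x - a)) (at x)"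
    if "x \<in> {a..b}" for x
    using assms(1)[OF that] by (auto intro!: derivative_eq_intros)
  show "((\<lambda>x. v' x - \<eta> * (x - a)) has_real_derivative v'' x - \<eta>) (at x)"
    if "x \<in> {a..b}" for x
    using assms(2)[OF that] by (auto intro!: derivative_eq_intros)
qed (use assms(3) in auto)

text \<open>
  Suppose \<open>v > - m'\<close> on an interval \<open>[a, a + L]\<close>.  Then \<open>v'' \<le> \<epsilon> + C m'\<close> there (the two terms
  come from the points where \<open>v\<close> is positive and negative), so \<open>v\<close> is almost concave.  An almost
  concave function that starts at \<open>m\<close> and ends almost nonnegative is at least \<open>m / 4\<close> on the first
  half of the interval.  There \<open>v'' \<le> - k\<close> with \<open>k\<close> of the order of \<open>\<mu> m\<^sup>3\<close>, and a function with values
  in \<open>[0, 1]\<close> can satisfy this only on an interval of length of the order of \<open>k\<^bsup>-1/2\<^esup>\<close>.  Hence \<open>L\<close> is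
  chosen first, from \<open>k\<close>, and then \<open>\<epsilon>\<close> and \<open>m'\<close> are small compared with \<open>m / L\<^sup>2\<close>.
\<close>

lemma drops_below:
  fixes \<mu> C m :: real
  assumes "\<mu> > 0" "C \<ge> 0" "m > 0"
  obtains \<epsilon> m' where "\<epsilon> > 0" "m' > 0"
    "\<And>a v. oscillator \<mu> C \<epsilon> a v \<Longrightarrow> v a \<ge> m \<Longrightarrow> \<exists>y>a. v y \<le> - m'"
proof -
  define k where "k = \<mu> * m^3 / 128"
  define L where "L = sqrt (64 / k)"
  define \<epsilon> where "\<epsilon> = min (m / (8 * L\<^sup>2)) (\<mu> * m\<^sup>2 / 32)"
  define m' where "m' = min (m / 4) (m / (8 * L\<^sup>2 * (C + 1)))"
  have k: "k > 0" using assms by (simp add: k_def)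
  have L2: "L\<^sup>2 = 64 / k" using k by (simp add: L_def)
  have L: "L > 0" using k by (simp add: L_def)
  have \<epsilon>: "\<epsilon> > 0" using assms L by (simp add: \<epsilon>_def)
  have m': "m' > 0" using assms L by (simp add: m'_def)
  define \<eta> where "\<eta> = \<epsilon> + C * m'"
  have \<eta>0: "\<eta> \<ge> 0" using \<epsilon> m' assms by (simp add: \<eta>_def)
  have \<epsilon>L: "\<epsilon> * L\<^sup>2 \<le> m / 8"
  proof -
    have "\<epsilon> * L\<^sup>2 \<le> m / (8 * L\<^sup>2) * L\<^sup>2" by (intro mult_right_mono) (auto simp: \<epsilon>_def)
    then show ?thesis using L by simp
  qed
  have m'L: "C * m' * L\<^sup>2 \<le> m / 8"
  proof -
    have "C * m' * L\<^sup>2 \<le> (C + 1) * m' * L\<^sup>2" using m' by (intro mult_right_mono) auto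
    also have "\<dots> \<le> (C + 1) * (m / (8 * L\<^sup>2 * (C + 1))) * L\<^sup>2"
      using assms by (intro mult_right_mono mult_left_mono) (auto simp: m'_def)
    also have "\<dots> = m / 8"
    proof -
      have "(C + 1) * (m / (8 * q * (C + 1))) * q = m / 8" if "q > 0" for q :: real
        using that assms(2) by (simp add: divide_simps)
      from this[of "L\<^sup>2"] show ?thesis using L by simp
    qed
    finally show ?thesis .
  qed
  have \<eta>L: "\<eta> * L\<^sup>2 \<le> m / 4" using \<epsilon>L m'L by (simp add: \<eta>_def algebra_simps)
  have "\<exists>y>a. v y \<le> - m'" if osc: "oscillator \<mu> C \<epsilon> a v" and va: "v a \<ge> m" for a v
  proof (rule ccontr)
    assume "\<not> ?thesis"
    then have low: "v y > - m'" if "y \<ge> a" for y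
      using that va m' assms by (cases "y = a") (auto simp: not_le)
    obtain v' c where ode: "\<And>x. x \<ge> a \<Longrightarrow> (v has_real_derivative v' x) (at x)"
      "\<And>x. x \<ge> a \<Longrightarrow> (v' has_real_derivative - (c x * v x)) (at x)"
      and bd: "\<And>x. x \<ge> a \<Longrightarrow> \<bar>v x\<bar> \<le> 1" "\<And>x. x \<ge> a \<Longrightarrow> \<mu> * (v x)\<^sup>2 - \<epsilon> \<le> c x"
        "\<And>x. x \<ge> a \<Longrightarrow> \<bar>c x\<bar> \<le> C"
      using osc unfolding oscillator_def by blast
    have almost_concave: "- (c x * v x) \<le> \<eta>" if x: "x \<ge> a" for x
    proof (cases "v x \<ge> 0")
      case True
      have "- c x \<le> \<epsilon>" using bd(2)[OF x] assms(1) zero_le_power2[of "v x"]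
        by (smt (verit) mult_nonneg_nonneg)
      then have "- c x * v x \<le> \<epsilon> * v x" using True by (intro mult_right_mono) auto
      also have "\<dots> \<le> \<epsilon>" using \<epsilon> bd(1)[OF x] True by (simp add: mult_left_le)
      finally show ?thesis using m' assms unfolding \<eta>_def by (smt (verit) mult_nonneg_nonneg mult_minus_left)
    next
      case False
      have "- (c x * v x) \<le> \<bar>c x\<bar> * \<bar>v x\<bar>" by (metis abs_ge_minus_self abs_mult)
      also have "\<dots> \<le> C * m'"
        using bd(3)[OF x] low[OF x] False by (intro mult_mono) auto
      finally show ?thesis using \<epsilon> by (simp add: \<eta>_def)
    qed
    have conc: "concave_on {a..a+L} (\<lambda>x. v x - \<eta> / 2 * (x - a)\<^sup>2)"
      by (rule concave_minus_parabola[where v' = v' and v'' = "\<lambda>x. - (c x * v x)"])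
        (use ode almost_concave in auto)
    have large: "v x \<ge> m / 4" if x: "x \<in> {a..a+L/2}" for x
    proof -
      define s where "s = (x - a) / L"
      have s: "0 \<le> s" "s \<le> 1 / 2" using x L by (auto simp: s_def field_simps)
      have xs: "x = (1 - s) * a + s * (a + L)" using L by (simp add: s_def field_simps)
      have "(1 - s) * v a + s * (v (a + L) - \<eta> / 2 * L\<^sup>2) \<le> v x - \<eta> / 2 * (x - a)\<^sup>2"
        using concave_onD[OF conc, of s a "a + L"] s L by (simp add: xs)
      also have "\<dots> \<le> v x" using \<eta>0 by simp
      finally have 1: "(1 - s) * v a + s * (v (a + L) - \<eta> / 2 * L\<^sup>2) \<le> v x" .
      have "v (a + L) - \<eta> / 2 * L\<^sup>2 \<ge> - (3 * m / 8)"
        using low[of "a + L"] L \<eta>L by (simp add: m'_def)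
      then have "s * (v (a + L) - \<eta> / 2 * L\<^sup>2) \<ge> s * (- (3 * m / 8))"
        using s by (intro mult_left_mono) auto
      moreover have "s * (3 * m / 8) \<le> 1 / 2 * (3 * m / 8)"
        using s assms by (intro mult_right_mono) auto
      moreover have "(1 - s) * v a \<ge> 1 / 2 * m" using s va assms by (intro mult_mono) auto
      ultimately show ?thesis using 1 assms(3) by linarith
    qed
    have strictly_concave: "- (c x * v x) \<le> - k" if x: "x \<in> {a..a+L/2}" for x
    proof -
      have "(m / 4)\<^sup>2 \<le> (v x)\<^sup>2" using large[OF x] assms by (intro power_mono) auto
      then have "\<mu> * (m / 4)\<^sup>2 \<le> \<mu> * (v x)\<^sup>2" using assms by (intro mult_left_mono) auto
      moreover have "\<epsilon> \<le> \<mu> * m\<^sup>2 / 32" by (simp add: \<epsilon>_def)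
      ultimately have "c x \<ge> \<mu> * m\<^sup>2 / 32"
        using bd(2)[of x] x by (simp add: power_divide)
      moreover from this have "c x \<ge> 0"
        using assms by (smt (verit) divide_nonneg_pos mult_nonneg_nonneg zero_le_power2)
      ultimately have "\<mu> * m\<^sup>2 / 32 * (m / 4) \<le> c x * v x"
        using large[OF x] assms by (intro mult_mono) auto
      then show ?thesis by (simp add: k_def power3_eq_cube power2_eq_square)
    qed
    have conc': "concave_on {a..a+L/2} (\<lambda>x. v x - (- k) / 2 * (x - a)\<^sup>2)"
      by (rule concave_minus_parabola[where v' = v' and v'' = "\<lambda>x. - (c x * v x)"])
        (use ode strictly_concave in auto)
    \<comment> \<open>Compare the value at the midpoint with the values at the ends, which are nonnegative.\<close>
    have "(1 - 1/2) * v a + 1/2 * (v (a + L/2) + k / 2 * (L/2)\<^sup>2)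
        \<le> v (a + L/4) + k / 2 * (L/4)\<^sup>2"
      using concave_onD[OF conc', of "1/2" a "a + L/2"] L by (simp add: algebra_simps)
    moreover have "v a \<ge> 0" "v (a + L/2) \<ge> 0" "v (a + L/4) \<le> 1"
      using large[of a] large[of "a + L/2"] bd(1)[of "a + L/4"] L assms by auto
    moreover have "k / 2 * (L/2)\<^sup>2 = k * L\<^sup>2 / 8" "k / 2 * (L/4)\<^sup>2 = k * L\<^sup>2 / 32"
      by (simp_all add: power_divide)
    ultimately have "k * L\<^sup>2 / 16 \<le> 1 + k * L\<^sup>2 / 32" by argo
    then show False using k by (simp add: L2)
  qed
  then show thesis using \<epsilon> m' that by blast
qed

lemma many_sign_changes:
  fixes \<mu> C m :: real
  assumes "\<mu> > 0" "C \<ge> 0" "m > 0"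
  shows "\<exists>\<epsilon>>0. \<forall>a v. oscillator \<mu> C \<epsilon> a v \<longrightarrow> \<bar>v a\<bar> \<ge> m \<longrightarrow>
    (\<exists>x :: nat \<Rightarrow> real. x 0 = a \<and> strict_mono_on {..k} x \<and> (\<forall>j<k. v (x j) * v (x (Suc j)) < 0))"
  using assms(3)
proof (induction k arbitrary: m)
  case 0
  show ?case by (auto intro!: exI[of _ 1] simp: strict_mono_on_def)
next
  case (Suc k)
  obtain \<epsilon> m' where step: "\<epsilon> > 0" "m' > 0"
    "\<And>a v. oscillator \<mu> C \<epsilon> a v \<Longrightarrow> v a \<ge> m \<Longrightarrow> \<exists>y>a. v y \<le> - m'"
    using drops_below[OF assms(1,2) Suc.prems] by metis
  obtain \<epsilon>' where IH: "\<epsilon>' > 0" "\<And>a v. oscillator \<mu> C \<epsilon>' a v \<Longrightarrow> \<bar>v a\<bar> \<ge> m' \<Longrightarrow>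
    (\<exists>x :: nat \<Rightarrow> real. x 0 = a \<and> strict_mono_on {..k} x \<and> (\<forall>j<k. v (x j) * v (x (Suc j)) < 0))"
    using Suc.IH[OF step(2)] by metis
  have "\<exists>x :: nat \<Rightarrow> real. x 0 = a \<and> strict_mono_on {..Suc k} x \<and>
          (\<forall>j<Suc k. v (x j) * v (x (Suc j)) < 0)"
    if osc: "oscillator \<mu> C (min \<epsilon> \<epsilon>') a v" and va: "\<bar>v a\<bar> \<ge> m" for a v
  proof -
    have osc1: "oscillator \<mu> C \<epsilon> a v" using osc by (rule oscillator_weaken) auto
    obtain y where y: "y > a" "\<bar>v y\<bar> \<ge> m'" "v a * v y < 0"
    proof (cases "v a \<ge> m")
      case True
      then obtain y where y: "y > a" "v y \<le> - m'" using step(3)[OF osc1] by blast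
      moreover have "v a * v y < 0"
        using y True step(2) Suc.prems by (intro mult_pos_neg) auto
      ultimately show thesis using that step(2) by fastforce
    next
      case False
      then have "- v a \<ge> m" using va by linarith
      then obtain y where y: "y > a" "- v y \<le> - m'"
        using step(3)[OF oscillator_uminus[OF osc1]] by blast
      moreover have "v a * v y < 0"
        using y False va step(2) Suc.prems by (intro mult_neg_pos) auto
      ultimately show thesis using that step(2) by fastforce
    qed
    have "oscillator \<mu> C \<epsilon>' y v" using osc by (rule oscillator_weaken) (use y in auto)
    from IH(2)[OF this y(2)] obtain x where x: "x 0 = y" "strict_mono_on {..k} x"
      "\<forall>j<k. v (x j) * v (x (Suc j)) < 0" by blast
    define z where "z = case_nat a x"
    have "strict_mono_on {..Suc k} z"
    proof (rule strict_mono_onI)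
      fix r s assume rs: "r \<in> {..Suc k}" "s \<in> {..Suc k}" "r < s"
      then obtain s' where s': "s = Suc s'" by (cases s) auto
      have ge: "y \<le> x s'"
        using x(1) strict_mono_onD[OF x(2), of 0 s'] s' rs by (cases "s' = 0") auto
      show "z r < z s"
        using ge y(1) s' rs strict_mono_onD[OF x(2)] by (cases r) (auto simp: z_def)
    qed
    moreover have "v (z j) * v (z (Suc j)) < 0" if "j < Suc k" for j
      using that x y(3) by (cases j) (auto simp: z_def)
    ultimately show ?thesis by (intro exI[of _ z]) (auto simp: z_def)
  qed
  then show ?case using step(1) IH(1) by (intro exI[of _ "min \<epsilon> \<epsilon>'"]) auto
qed

text \<open>
  The bounds on the coefficient are homogeneous of degree two in the amplitude \<open>A\<close>, so that
  \<open>\<epsilon>\<close> does not depend on \<open>A\<close>.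
\<close>

lemma alternates_of_amplitude:
  fixes \<mu> C :: real
  assumes "\<mu> > 0" "C \<ge> 0"
  shows "\<exists>\<epsilon>>0. \<forall>A a u u' c. A > 0 \<longrightarrow> a > 0 \<longrightarrow> \<bar>u a\<bar> \<ge> A / 2 \<longrightarrow>
    (\<forall>x>0. (u has_real_derivative u' x) (at x) \<and> (u' has_real_derivative - (c x * u x)) (at x) \<and>
       \<bar>u x\<bar> \<le> A \<and> \<mu> * (u x)\<^sup>2 - \<epsilon> * A\<^sup>2 \<le> c x \<and> \<bar>c x\<bar> \<le> C * A\<^sup>2) \<longrightarrow>
    alternates u k"
proof -
  obtain \<epsilon> where \<epsilon>: "\<epsilon> > 0" and osc: "\<And>a v. oscillator \<mu> C \<epsilon> a v \<Longrightarrow> \<bar>v a\<bar> \<ge> 1 / 2 \<Longrightarrow>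
    (\<exists>x :: nat \<Rightarrow> real. x 0 = a \<and> strict_mono_on {..k} x \<and> (\<forall>j<k. v (x j) * v (x (Suc j)) < 0))"
    using many_sign_changes[OF assms, of "1/2" k] by auto
  have "alternates u k"
    if A: "A > 0" and a: "a > 0" "\<bar>u a\<bar> \<ge> A / 2"
      and u: "\<And>x. x > 0 \<Longrightarrow> (u has_real_derivative u' x) (at x)"
      and u': "\<And>x. x > 0 \<Longrightarrow> (u' has_real_derivative - (c x * u x)) (at x)"
      and bd: "\<And>x. x > 0 \<Longrightarrow> \<bar>u x\<bar> \<le> A"
      and c: "\<And>x. x > 0 \<Longrightarrow> \<mu> * (u x)\<^sup>2 - \<epsilon> * A\<^sup>2 \<le> c x" "\<And>x. x > 0 \<Longrightarrow> \<bar>c x\<bar> \<le> C * A\<^sup>2"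
    for A a u u' c
  proof -
    define v where "v = (\<lambda>x. u (x / A) / A)"
    have "oscillator \<mu> C \<epsilon> (a * A) v"
      unfolding oscillator_def
    proof (intro exI allI impI conjI)
      fix x assume "x \<ge> a * A"
      then have x: "x / A > 0" using a A by (smt (verit) divide_pos_pos mult_pos_pos)
      have D: "((\<lambda>x. f (x / A)) has_real_derivative d * (1 / A)) (at x)"
        if "(f has_real_derivative d) (at (x / A))" for f d
        using DERIV_chain2[of f d "\<lambda>x. x / A" x "1 / A" UNIV] that
          DERIV_cdivide[OF DERIV_ident, of A x UNIV] by blast
      show "(v has_real_derivative u' (x / A) / A\<^sup>2) (at x)"
        using DERIV_cdivide[OF D[OF u[OF x]], of A]
        by (simp add: v_def power2_eq_square)
      show "((\<lambda>x. u' (x / A) / A\<^sup>2) has_real_derivative - (c (x / A) / A\<^sup>2 * v x)) (at x)"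
        using DERIV_cdivide[OF D[OF u'[OF x]], of "A\<^sup>2"]
        by (simp add: v_def power2_eq_square mult.assoc)
      show "\<bar>v x\<bar> \<le> 1" using bd[OF x] A by (simp add: v_def)
      show "\<mu> * (v x)\<^sup>2 - \<epsilon> \<le> c (x / A) / A\<^sup>2"
      proof -
        have "(\<mu> * (u (x / A))\<^sup>2 - \<epsilon> * A\<^sup>2) / A\<^sup>2 \<le> c (x / A) / A\<^sup>2"
          using c(1)[OF x] by (intro divide_right_mono) auto
        then show ?thesis using A by (simp add: v_def power_divide diff_divide_distrib)
      qed
      show "\<bar>c (x / A) / A\<^sup>2\<bar> \<le> C" using c(2)[OF x] A by (simp add: field_simps)
    qed
    moreover have "\<bar>v (a * A)\<bar> \<ge> 1 / 2" using a A by (simp add: v_def field_simps)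
    ultimately obtain x where x: "x 0 = a * A" "strict_mono_on {..k} x"
      "\<forall>j<k. v (x j) * v (x (Suc j)) < 0" using osc by blast
    have "strict_mono_on {..k} (\<lambda>i. x i / A)"
      using x(2) A by (auto simp: strict_mono_on_def divide_strict_right_mono)
    moreover have "u (x j / A) * u (x (Suc j) / A) < 0" if "j < k" for j
    proof -
      have "v (x j) * v (x (Suc j)) < 0" using x(3) that by blast
      then show ?thesis using A
        by (auto simp: v_def divide_less_0_iff mult_less_0_iff zero_less_divide_iff)
    qed
    ultimately show ?thesis
      unfolding alternates_def using x(1) a A by (intro exI[of _ "\<lambda>i. x i / A"]) auto
  qed
  then show ?thesis using \<epsilon> by (intro exI[of _ \<epsilon>]) blast
qed

section \<open>Systems on the open half-line\<close>

lemma bounded_family_amplitude: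
  fixes u :: "'i \<Rightarrow> real \<Rightarrow> real"
  assumes "\<And>j x. j \<in> I \<Longrightarrow> x \<in> S \<Longrightarrow> \<bar>u j x\<bar> \<le> B" and "\<exists>j\<in>I. \<exists>x\<in>S. u j x \<noteq> 0"
  obtains A j a where "A > 0" "\<And>i x. i \<in> I \<Longrightarrow> x \<in> S \<Longrightarrow> \<bar>u i x\<bar> \<le> A"
    "j \<in> I" "a \<in> S" "\<bar>u j a\<bar> \<ge> A / 2"
proof -
  define T where "T = (\<lambda>(j, x). \<bar>u j x\<bar>) ` (I \<times> S)"
  define A where "A = Sup T"
  have bdd: "bdd_above T" using assms(1) by (auto simp: T_def intro!: bdd_aboveI[of _ B])
  have le: "\<bar>u i x\<bar> \<le> A" if "i \<in> I" "x \<in> S" for i x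
    unfolding A_def using that by (intro cSup_upper bdd) (auto simp: T_def)
  obtain i y where iy: "i \<in> I" "y \<in> S" "u i y \<noteq> 0" using assms(2) by blast
  then have A: "A > 0" using le[of i y] by auto
  have "T \<noteq> {}" using iy by (auto simp: T_def)
  then obtain t where "t \<in> T" "A / 2 < t" using less_cSupD[of T "A / 2"] A by (auto simp: A_def)
  then obtain j a where "j \<in> I" "a \<in> S" "\<bar>u j a\<bar> \<ge> A / 2" by (auto simp: T_def)
  with that A le show thesis by blast
qed

definition half_line_solution ::
  "nat \<Rightarrow> (nat \<Rightarrow> real) \<Rightarrow> (nat \<Rightarrow> nat \<Rightarrow> real) \<Rightarrow> (nat \<Rightarrow> real \<Rightarrow> real) \<Rightarrow> bool" where
  "half_line_solution N \<mu> b u \<longleftrightarrow> (\<exists>u'. \<forall>j\<in>{1..N}. \<forall>x>0.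
     (u j has_real_derivative u' j x) (at x) \<and>
     (u' j has_real_derivative
        - (\<mu> j * (u j x)^3 + (\<Sum>i\<in>{1..N} - {j}. b i j * (u i x)^2 * u j x))) (at x))"

text \<open>
  A nontrivial bounded solution may have components that vanish identically; the component that
  has too many sign changes is one that is not small compared with the others.
\<close>

lemma half_line_system_alternates:
  fixes N :: nat and \<mu> :: "nat \<Rightarrow> real" and P :: "nat \<Rightarrow> nat" and \<beta> :: real
  assumes N: "N \<ge> 1" and \<mu>: "\<forall>j\<in>{1..N}. \<mu> j > 0" and \<beta>: "\<beta> \<ge> 0"
  shows "\<exists>\<epsilon>>0. \<forall>b u. (\<forall>i\<in>{1..N}. \<forall>j\<in>{1..N}. i \<noteq> j \<longrightarrow> b i j \<in> {-\<epsilon>..\<beta>}) \<longrightarrow>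
    half_line_solution N \<mu> b u \<longrightarrow> (\<forall>j\<in>{1..N}. \<forall>x>0. \<bar>u j x\<bar> \<le> 1) \<longrightarrow>
    (\<exists>j\<in>{1..N}. \<exists>x>0. u j x \<noteq> 0) \<longrightarrow>
    (\<exists>j\<in>{1..N}. (\<exists>x>0. u j x \<noteq> 0) \<and> alternates (u j) (Suc (P j)))"
proof -
  define C where "C = (\<lambda>j. \<mu> j + real N * (\<beta> + 1))"
  have C: "C j \<ge> 0" if "j \<in> {1..N}" for j
    using \<mu> \<beta> that unfolding C_def by (intro add_nonneg_nonneg) (auto intro: less_imp_le)
  have "\<forall>j\<in>{1..N}. \<exists>\<epsilon>>0. \<forall>A a u u' c. A > 0 \<longrightarrow> a > 0 \<longrightarrow> \<bar>u a\<bar> \<ge> A / 2 \<longrightarrow>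
    (\<forall>x>0. (u has_real_derivative u' x) (at x) \<and> (u' has_real_derivative - (c x * u x)) (at x) \<and>
       \<bar>u x\<bar> \<le> A \<and> \<mu> j * (u x)\<^sup>2 - \<epsilon> * A\<^sup>2 \<le> c x \<and> \<bar>c x\<bar> \<le> C j * A\<^sup>2) \<longrightarrow>
    alternates u (Suc (P j))"
    using alternates_of_amplitude \<mu> C by blast
  then obtain E where E: "\<And>j. j \<in> {1..N} \<Longrightarrow> E j > 0"
    "\<And>j A a u u' c. j \<in> {1..N} \<Longrightarrow> A > 0 \<Longrightarrow> a > 0 \<Longrightarrow> \<bar>u a\<bar> \<ge> A / 2 \<Longrightarrow>
      (\<forall>x>0. (u has_real_derivative u' x) (at x) \<and> (u' has_real_derivative - (c x * u x)) (at x) \<and>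
       \<bar>u x\<bar> \<le> A \<and> \<mu> j * (u x)\<^sup>2 - E j * A\<^sup>2 \<le> c x \<and> \<bar>c x\<bar> \<le> C j * A\<^sup>2) \<Longrightarrow>
      alternates u (Suc (P j))"
    by (subst (asm) bchoice_iff) metis
  \<comment> \<open>The coefficient collects fewer than \<open>N\<close> coupling terms, each at least \<open>- \<epsilon> A\<^sup>2\<close>; the bound
    \<open>\<epsilon> \<le> 1\<close> makes the constants \<open>C\<close> independent of \<open>\<epsilon>\<close>.\<close>
  define \<epsilon> where "\<epsilon> = min 1 (Min (E ` {1..N})) / real N"
  have "Min (E ` {1..N}) > 0" using E(1) N by (subst Min_gr_iff) auto
  then have \<epsilon>: "\<epsilon> > 0" using N by (simp add: \<epsilon>_def)
  have N\<epsilon>: "real N * \<epsilon> = min 1 (Min (E ` {1..N}))" using N by (simp add: \<epsilon>_def)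
  have N\<epsilon>E: "real N * \<epsilon> \<le> E j" if "j \<in> {1..N}" for j
    unfolding N\<epsilon> using that by (intro min.coboundedI2 Min_le) auto
  have "\<epsilon> \<le> real N * \<epsilon>" using N \<epsilon> by simp
  then have \<epsilon>1: "\<epsilon> \<le> 1" using N\<epsilon> by linarith
  have "\<exists>j\<in>{1..N}. (\<exists>x>0. u j x \<noteq> 0) \<and> alternates (u j) (Suc (P j))"
    if b: "\<forall>i\<in>{1..N}. \<forall>j\<in>{1..N}. i \<noteq> j \<longrightarrow> b i j \<in> {-\<epsilon>..\<beta>}"
      and sol: "half_line_solution N \<mu> b u"
      and bd: "\<forall>j\<in>{1..N}. \<forall>x>0. \<bar>u j x\<bar> \<le> 1"
      and nz: "\<exists>j\<in>{1..N}. \<exists>x>0. u j x \<noteq> 0" for b u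
  proof -
    obtain u' where u: "\<And>j x. j \<in> {1..N} \<Longrightarrow> x > 0 \<Longrightarrow> (u j has_real_derivative u' j x) (at x)"
      and u': "\<And>j x. j \<in> {1..N} \<Longrightarrow> x > 0 \<Longrightarrow> (u' j has_real_derivative
          - (\<mu> j * (u j x)^3 + (\<Sum>i\<in>{1..N} - {j}. b i j * (u i x)^2 * u j x))) (at x)"
      using sol unfolding half_line_solution_def by blast
    obtain A j a where A: "A > 0" and le: "\<And>i x. i \<in> {1..N} \<Longrightarrow> x > 0 \<Longrightarrow> \<bar>u i x\<bar> \<le> A"
      and j: "j \<in> {1..N}" and a: "a > 0" "\<bar>u j a\<bar> \<ge> A / 2"
    proof (rule bounded_family_amplitude[of "{1..N}" "{0<..}" u 1])
      show "\<exists>j\<in>{1..N}. \<exists>x\<in>{0<..}. u j x \<noteq> 0" using nz by auto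
    qed (use bd in auto)
    define g where "g = (\<lambda>x. \<Sum>i\<in>{1..N} - {j}. b i j * (u i x)\<^sup>2)"
    define c where "c = (\<lambda>x. \<mu> j * (u j x)\<^sup>2 + g x)"
    have sq: "(u i x)\<^sup>2 \<le> A\<^sup>2" if "i \<in> {1..N}" "x > 0" for i x
      using power_mono[OF le[OF that], of 2] by simp
    have card: "real (card ({1..N} - {j})) \<le> real N" using j by simp
    have g_ge: "- (E j * A\<^sup>2) \<le> g x" if x: "x > 0" for x
    proof -
      have "- (E j * A\<^sup>2) \<le> - (real N * \<epsilon> * A\<^sup>2)"
        using N\<epsilon>E[OF j] by (simp add: mult_right_mono)
      also have "\<dots> \<le> - (real (card ({1..N} - {j})) * (\<epsilon> * A\<^sup>2))"
        using mult_right_mono[OF card, of "\<epsilon> * A\<^sup>2"] \<epsilon> by (simp add: mult.assoc)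
      also have "\<dots> = (\<Sum>i\<in>{1..N} - {j}. - (\<epsilon> * A\<^sup>2))" by simp
      also have "\<dots> \<le> g x" unfolding g_def
      proof (rule sum_mono)
        fix i assume i: "i \<in> {1..N} - {j}"
        have "\<epsilon> * (u i x)\<^sup>2 \<le> \<epsilon> * A\<^sup>2" using sq[of i x] i x \<epsilon> by (intro mult_left_mono) auto
        moreover have "- \<epsilon> * (u i x)\<^sup>2 \<le> b i j * (u i x)\<^sup>2"
          using b i j by (intro mult_right_mono) auto
        ultimately show "- (\<epsilon> * A\<^sup>2) \<le> b i j * (u i x)\<^sup>2" by simp
      qed
      finally show ?thesis .
    qed
    have g_abs: "\<bar>g x\<bar> \<le> real N * (\<beta> + 1) * A\<^sup>2" if x: "x > 0" for x
    proof -
      have "\<bar>g x\<bar> \<le> (\<Sum>i\<in>{1..N} - {j}. (\<beta> + 1) * A\<^sup>2)"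
        unfolding g_def
      proof (rule order_trans[OF sum_abs sum_mono])
        fix i assume i: "i \<in> {1..N} - {j}"
        have "b i j \<in> {-\<epsilon>..\<beta>}" using b i j by auto
        then have "\<bar>b i j\<bar> \<le> \<beta> + 1" using \<epsilon>1 \<epsilon> \<beta> by auto
        then show "\<bar>b i j * (u i x)\<^sup>2\<bar> \<le> (\<beta> + 1) * A\<^sup>2"
          using sq[of i x] i x \<beta> by (simp add: abs_mult mult_mono)
      qed
      also have "\<dots> = real (card ({1..N} - {j})) * ((\<beta> + 1) * A\<^sup>2)" by simp
      also have "\<dots> \<le> real N * ((\<beta> + 1) * A\<^sup>2)"
        using card \<beta> by (intro mult_right_mono) auto
      finally show ?thesis by (simp add: mult.assoc)
    qed
    have "alternates (u j) (Suc (P j))"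
    proof (rule E(2)[where u = "u j" and u' = "u' j" and c = c, OF j A a], intro allI impI conjI)
      fix x :: real assume x: "x > 0"
      show "(u j has_real_derivative u' j x) (at x)" using u j x by blast
      have "\<mu> j * (u j x)^3 + (\<Sum>i\<in>{1..N} - {j}. b i j * (u i x)^2 * u j x) = c x * u j x"
        by (simp add: c_def g_def sum_distrib_right distrib_right power3_eq_cube power2_eq_square)
      then show "(u' j has_real_derivative - (c x * u j x)) (at x)" using u'[OF j x] by simp
      show "\<bar>u j x\<bar> \<le> A" using le j x by blast
      show "\<mu> j * (u j x)\<^sup>2 - E j * A\<^sup>2 \<le> c x" using g_ge[OF x] by (simp add: c_def)
      have "\<mu> j > 0" using \<mu> j by blast
      then have "0 \<le> \<mu> j * (u j x)\<^sup>2" "\<mu> j * (u j x)\<^sup>2 \<le> \<mu> j * A\<^sup>2"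
        using sq[OF j x] by auto
      then show "\<bar>c x\<bar> \<le> C j * A\<^sup>2"
        using g_abs[OF x] by (simp add: c_def C_def distrib_right)
    qed
    moreover have "u j a \<noteq> 0" using a A by auto
    ultimately show ?thesis using j a by blast
  qed
  with \<epsilon> show ?thesis by (intro exI[of _ \<epsilon>] conjI allI impI) simp_all
qed

section \<open>Reduction to the open half-line\<close>

lemma deriv_on_interior:
  assumes "u differentiable_on S" "x \<in> interior S"
  shows "(u has_real_derivative deriv_on S u x) (at x)"
proof -
  have "x \<in> S" using assms(2) interior_subset by blast
  then have "u differentiable (at x within S)" using assms(1) by (simp add: differentiable_on_def)
  then show ?thesis
    using at_within_interior[OF assms(2)]
    by (simp add: deriv_on_def vector_derivative_works has_real_derivative_iff_has_vector_derivative)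
qed

text \<open>A continuous function satisfies an almost everywhere bound at every interior point, because
  the set where it fails is open.\<close>

lemma Linf_norm_bound_interior:
  assumes "Linf_norm S u \<le> ereal B" "continuous_on S u" "S \<in> sets lebesgue" "x \<in> interior S"
  shows "\<bar>u x\<bar> \<le> B"
proof (rule ccontr)
  assume x: "\<not> \<bar>u x\<bar> \<le> B"
  define T where "T = {y \<in> interior S. B < \<bar>u y\<bar>}"
  have "AE y in lebesgue_on S. ereal \<bar>u y\<bar> \<le> ereal B"
    using esssup_AE[where f = "\<lambda>x. ereal \<bar>u x\<bar>" and M = "lebesgue_on S"]
    by (rule eventually_mono) (use assms(1) order_trans in \<open>unfold Linf_norm_def, blast\<close>)
  then have "AE y in lebesgue. y \<in> S \<longrightarrow> \<bar>u y\<bar> \<le> B"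
    using assms(3) by (simp add: AE_restrict_space_iff)
  then have "negligible {y. \<not> (y \<in> S \<longrightarrow> \<bar>u y\<bar> \<le> B)}"
    by (simp add: completion.AE_iff_null_sets negligible_iff_null_sets)
  then have "negligible T"
    by (rule negligible_subset) (use interior_subset in \<open>auto simp: T_def\<close>)
  moreover have "open T"
  proof -
    have "continuous_on (interior S) (\<lambda>y. \<bar>u y\<bar>)"
      using assms(2) interior_subset by (intro continuous_intros) (rule continuous_on_subset)
    moreover have "T = (\<lambda>y. \<bar>u y\<bar>) -` {B<..} \<inter> interior S" by (auto simp: T_def)
    ultimately show ?thesis
      using continuous_on_open_vimage[OF open_interior] open_greaterThan by metis
  qed
  moreover have "x \<in> T" using x assms(4) by (simp add: T_def)
  ultimately show False using open_not_negligible by blast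
qed

lemma num_nodes_le_imp_not_alternates:
  assumes "num_nodes u \<le> enat k"
  shows "\<not> alternates u (Suc k)"
proof
  assume "alternates u (Suc k)"
  then have "enat (Suc k) \<le> num_nodes u" unfolding num_nodes_def by (intro Sup_upper) auto
  with assms show False using order_trans by fastforce
qed

text \<open>
  The whole line and the closed half-line are treated together, as sets \<open>S\<close> that contain the open
  half-line in their interior, where the relative derivatives are ordinary ones.
\<close>

theorem theorem2p7:
  fixes N :: nat and \<mu> :: "nat \<Rightarrow> real" and P :: "nat \<Rightarrow> nat" and \<beta> :: real
  assumes "N \<ge> 1" and "\<forall>j\<in>{1..N}. \<mu> j > 0" and "\<beta> \<ge> 0"
  shows "\<exists>\<epsilon>\<^sub>2>0. \<forall>b :: nat \<Rightarrow> nat \<Rightarrow> real.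
    (\<forall>i\<in>{1..N}. \<forall>j\<in>{1..N}. i \<noteq> j \<longrightarrow> b i j \<in> {-\<epsilon>\<^sub>2..\<beta>}) \<longrightarrow>
    (\<nexists>u :: nat \<Rightarrow> real \<Rightarrow> real.
       (\<exists>j\<in>{1..N}. \<exists>x. u j x \<noteq> 0) \<and>
       solves_system UNIV N \<mu> b u \<and>
       (\<forall>j\<in>{1..N}.
          C2_on UNIV (u j) \<and> radial (u j) \<and>
          ((\<forall>x. u j x = 0) \<or> num_nodes (u j) \<le> enat (P j)) \<and>
          Linf_norm UNIV (u j) \<le> 1)) \<and>
    (\<nexists>u :: nat \<Rightarrow> real \<Rightarrow> real.
       (\<exists>j\<in>{1..N}. \<exists>x\<in>{0..}. u j x \<noteq> 0) \<and>
       solves_system {0..} N \<mu> b u \<and>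
       (\<forall>j\<in>{1..N}.
          C2_on {0..} (u j) \<and>
          ((\<forall>x\<in>{0..}. u j x = 0) \<or> num_nodes (u j) \<le> enat (P j)) \<and>
          Linf_norm {0..} (u j) \<le> 1 \<and>
          u j 0 = 0))"
proof -
  obtain \<epsilon> where \<epsilon>: "\<epsilon> > 0" and alt:
    "\<forall>b u. (\<forall>i\<in>{1..N}. \<forall>j\<in>{1..N}. i \<noteq> j \<longrightarrow> b i j \<in> {-\<epsilon>..\<beta>}) \<longrightarrow>
    half_line_solution N \<mu> b u \<longrightarrow> (\<forall>j\<in>{1..N}. \<forall>x>0. \<bar>u j x\<bar> \<le> 1) \<longrightarrow>
    (\<exists>j\<in>{1..N}. \<exists>x>0. u j x \<noteq> 0) \<longrightarrow>
    (\<exists>j\<in>{1..N}. (\<exists>x>0. u j x \<noteq> 0) \<and> alternates (u j) (Suc (P j)))"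
    using half_line_system_alternates[OF assms, of P] by auto
  have key: False
    if b: "\<forall>i\<in>{1..N}. \<forall>j\<in>{1..N}. i \<noteq> j \<longrightarrow> b i j \<in> {-\<epsilon>..\<beta>}"
      and S: "{0<..} \<subseteq> S" "S \<in> sets lebesgue"
      and sys: "solves_system S N \<mu> b u"
      and u: "\<And>j. j \<in> {1..N} \<Longrightarrow> C2_on S (u j)"
        "\<And>j. j \<in> {1..N} \<Longrightarrow> (\<forall>x\<in>S. u j x = 0) \<or> num_nodes (u j) \<le> enat (P j)"
        "\<And>j. j \<in> {1..N} \<Longrightarrow> Linf_norm S (u j) \<le> 1"
      and nz: "\<exists>j\<in>{1..N}. \<exists>x>0. u j x \<noteq> 0"
    for b u and S :: "real set"
  proof -
    have int: "x \<in> interior S" if "x > 0" for x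
      using interior_maximal[OF S(1)] that by auto
    have d: "u j differentiable_on S" "deriv_on S (u j) differentiable_on S"
      if "j \<in> {1..N}" for j
      using u(1)[OF that] by (auto simp: C2_on_def)
    have "half_line_solution N \<mu> b u"
      unfolding half_line_solution_def
    proof (intro exI[of _ "\<lambda>j. deriv_on S (u j)"] ballI allI impI conjI)
      fix j and x :: real assume jx: "j \<in> {1..N}" "x > 0"
      show "(u j has_real_derivative deriv_on S (u j) x) (at x)"
        using deriv_on_interior[OF d(1)[OF jx(1)] int[OF jx(2)]] .
      have "x \<in> S" using S jx by auto
      then have "- deriv_on S (deriv_on S (u j)) x
          = \<mu> j * (u j x)^3 + (\<Sum>i\<in>{1..N} - {j}. b i j * (u i x)^2 * u j x)"
        using sys jx(1) unfolding solves_system_def by blast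
      then have "deriv_on S (deriv_on S (u j)) x
          = - (\<mu> j * (u j x)^3 + (\<Sum>i\<in>{1..N} - {j}. b i j * (u i x)^2 * u j x))"
        by linarith
      then show "(deriv_on S (u j) has_real_derivative
          - (\<mu> j * (u j x)^3 + (\<Sum>i\<in>{1..N} - {j}. b i j * (u i x)^2 * u j x))) (at x)"
        using deriv_on_interior[OF d(2)[OF jx(1)] int[OF jx(2)]] by metis
    qed
    moreover have "\<forall>j\<in>{1..N}. \<forall>x>0. \<bar>u j x\<bar> \<le> 1"
      using Linf_norm_bound_interior[of S _ 1] u(3) S(2) int
        differentiable_imp_continuous_on[OF d(1)] by (simp add: one_ereal_def)
    ultimately have "\<exists>j\<in>{1..N}. (\<exists>x>0. u j x \<noteq> 0) \<and> alternates (u j) (Suc (P j))"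
      using alt b nz by blast
    then obtain j x where j: "j \<in> {1..N}" "x > 0" "u j x \<noteq> 0" "alternates (u j) (Suc (P j))"
      by blast
    moreover have "x \<in> S" using S j by auto
    ultimately show False using u(2)[OF j(1)] num_nodes_le_imp_not_alternates by blast
  qed
  show ?thesis
  proof (intro exI[of _ \<epsilon>] conjI \<epsilon> allI impI notI)
    fix b :: "nat \<Rightarrow> nat \<Rightarrow> real"
    assume b: "\<forall>i\<in>{1..N}. \<forall>j\<in>{1..N}. i \<noteq> j \<longrightarrow> b i j \<in> {-\<epsilon>..\<beta>}"
    {
      assume "\<exists>u. (\<exists>j\<in>{1..N}. \<exists>x. u j x \<noteq> 0) \<and> solves_system UNIV N \<mu> b u \<and>
       (\<forall>j\<in>{1..N}. C2_on UNIV (u j) \<and> radial (u j) \<and>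
          ((\<forall>x. u j x = 0) \<or> num_nodes (u j) \<le> enat (P j)) \<and> Linf_norm UNIV (u j) \<le> 1)"
      then obtain u where u: "\<exists>j\<in>{1..N}. \<exists>x. u j x \<noteq> 0" "solves_system UNIV N \<mu> b u"
        "\<forall>j\<in>{1..N}. C2_on UNIV (u j) \<and> radial (u j) \<and>
          ((\<forall>x. u j x = 0) \<or> num_nodes (u j) \<le> enat (P j)) \<and> Linf_norm UNIV (u j) \<le> 1"
        by blast
      obtain j x where j: "j \<in> {1..N}" "u j x \<noteq> 0" using u(1) by blast
      have "continuous_on UNIV (u j)"
        using u(3) j(1) differentiable_imp_continuous_on unfolding C2_on_def by blast
      have "\<exists>y>0. u j y \<noteq> 0"
      proof (rule ccontr)
        \<comment> \<open>Continuity excludes a component that is nonzero at \<open>0\<close> only.\<close>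
        assume "\<not> (\<exists>y>0. u j y \<noteq> 0)"
        then have 0: "u j y = 0" if "y \<in> {0<..}" for y using that by auto
        have "u j y = 0" if "y \<in> closure {0<..}" for y
          by (rule continuous_constant_on_closure[OF _ 0 that])
            (use \<open>continuous_on UNIV (u j)\<close> continuous_on_subset in blast)
        then have "u j \<bar>x\<bar> = 0" by simp
        moreover have "u j x = u j \<bar>x\<bar>" using u(3) j(1) unfolding radial_def by (metis abs_abs)
        ultimately show False using j(2) by simp
      qed
      then show False using j(1) u by (intro key[OF b, of UNIV u]) auto
    next
      assume "\<exists>u. (\<exists>j\<in>{1..N}. \<exists>x\<in>{0..}. u j x \<noteq> 0) \<and> solves_system {0..} N \<mu> b u \<and>
       (\<forall>j\<in>{1..N}. C2_on {0..} (u j) \<and>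
          ((\<forall>x\<in>{0..}. u j x = 0) \<or> num_nodes (u j) \<le> enat (P j)) \<and>
          Linf_norm {0..} (u j) \<le> 1 \<and> u j 0 = 0)"
      then obtain u where u: "\<exists>j\<in>{1..N}. \<exists>x\<in>{0..}. u j x \<noteq> 0" "solves_system {0..} N \<mu> b u"
        "\<forall>j\<in>{1..N}. C2_on {0..} (u j) \<and>
          ((\<forall>x\<in>{0..}. u j x = 0) \<or> num_nodes (u j) \<le> enat (P j)) \<and>
          Linf_norm {0..} (u j) \<le> 1 \<and> u j 0 = 0"
        by blast
      obtain j x where j: "j \<in> {1..N}" "x \<ge> 0" "u j x \<noteq> 0" using u(1) by auto
      then have "x > 0" using u(3) by (cases "x = 0") auto
      then have "\<exists>j\<in>{1..N}. \<exists>x>0. u j x \<noteq> 0" using j by blast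
      then show False using u by (intro key[OF b, of "{0..}" u]) auto
    }
  qed
qed

end
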